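(* Every Wasserstein family $(K_n,d_n,m_n)_{n\ge1}$ of measure metric groups is a Lévy family.
   Context: A measure metric group $(K,d,m)$ consists of a compact metrizable group $K$, a compatible right-invariant metric $d$ on $K$ (so $d(xg,yg)=d(x,y)$), and the Haar probability measure $m$ of $K$. **Lévy families.** The sequence $(K_n,d_n,m_n)_{n\ge1}$ is a Lévy family if $\alpha_{(K_n,d_n,m_n)}(\epsilon)\to0$ for every $\epsilon>0$, where $\alpha_{(K,d,m)}(\epsilon):=1-\inf\{m(B_d(A,\epsilon)): A\subseteq K \text{ Borel},\ m(A)\ge1/2\}$ and $B_d(A,\epsilon)$ is the $\epsilon$-neighborhood of $A$ in $(K,d)$. **Wasserstein families.** Write $e_K$ for the identity and $B_d(r):=\{h\in K: d(e_K,h)\le r\}$. Let $\mathcal{D}(K,m):=\{\phi\in L^1(K,m):\phi\ge 0,\ \int_K\phi\,dm=1\}$; for $\phi\in\mathcal{D}(K,m)$ let $\phi m$ be the probability measure with density $\phi$ with respect to $m$, and for $h\in K$ put $(h.\phi)(g):=\phi(h^{-1}g)$. Put $\mathbf{V}_m(\phi,\phi'):=\frac12\int_K|\phi-\phi'|\,dm$, and for Borel probability measures $\alpha,\beta$ on $K$ put $\mathbf{W}_d(\alpha,\beta):=\sup_f\left|\int f\,d\alpha-\int f\,d\beta\right|$, the supremum over all real functions $f$ on $K$ that are $1$-Lipschitz with respect to $d$. A $\mathcal{D}(K,m)$-valued measurable kernel is a family $\Phi=\{\phi_z:z\in Z\}\subset\mathcal{D}(K,m)$ indexed by a probability space $(Z,\zeta)$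 and measurable (i.e. $(z,g)\mapsto\phi_z(g)$ is measurable). Put $$\mathbf{v}_m(\Phi,r):=\sup_{h\in B_d(r)}\int_Z\mathbf{V}_m(h.\phi_z,\phi_z)\,d\zeta(z),\qquad \mathbf{w}_d(\Phi):=\int_Z\mathbf{W}_d(\phi_z m,m)\,d\zeta(z),$$ and, for $r,\epsilon>0$, $\Omega_{(K,d,m)}(r,\epsilon):=\sup\{\mathbf{w}_d(\Phi):\mathbf{v}_m(\Phi,r)\le\epsilon\}$, the supremum over all $\mathcal{D}(K,m)$-valued measurable kernels $\Phi$ (over all probability spaces). The sequence $(K_n,d_n,m_n)_{n\ge1}$ is a Wasserstein family if there is a sequence of positive numbers $r_n\to0$ such that $\Omega_{(K_n,d_n,m_n)}(r_n,\epsilon_n)\to0$ for every sequence of positive numbers $\epsilon_n\to0$. *)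

theory Defs
  imports "HOL-Analysis.Analysis" "HOL-Probability.Probability" "HOL-Algebra.Coset"
begin

text \<open>
  The topology of the group is the metric topology of \<open>d\<close>, so that compatibility of the metric
  is built in. Haar measure is the left-invariant Borel probability measure.
\<close>

locale measure_metric_group =
  group G + Metric_space "carrier G" d + prob_space m
  for G :: "('a, 'b) monoid_scheme" (structure) and d :: "'a \<Rightarrow> 'a \<Rightarrow> real" and m :: "'a measure" +
  assumes continuous_mult:
      "continuous_map (prod_topology mtopology mtopology) mtopology (\<lambda>(x, y). x \<otimes> y)"
    and continuous_inv: "continuous_map mtopology mtopology (\<lambda>x. inv x)"
    and compact_group: "compact_space mtopology"
    and right_invariant_metric:
      "\<And>x y g. x \<in> carrier G \<Longrightarrow> y \<in> carrier G \<Longrightarrow> g \<in> carrier G \<Longrightarrow> d (x \<otimes> g) (y \<otimes> g) = d x y"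
    and space_Haar: "space m = carrier G"
    and sets_Haar: "sets m = sigma_sets (carrier G) {U. openin mtopology U}"
    and left_invariant_Haar:
      "\<And>h A. h \<in> carrier G \<Longrightarrow> A \<in> sets m \<Longrightarrow> emeasure m (h <# A) = emeasure m A"

definition nbhd :: "'a set \<Rightarrow> ('a \<Rightarrow> 'a \<Rightarrow> real) \<Rightarrow> 'a set \<Rightarrow> real \<Rightarrow> 'a set" where
  "nbhd K d A \<epsilon> = (\<Union>a\<in>A. Metric_space.mball K d a \<epsilon>)"

definition concentration_function ::
    "'a set \<Rightarrow> ('a \<Rightarrow> 'a \<Rightarrow> real) \<Rightarrow> 'a measure \<Rightarrow> real \<Rightarrow> real" where
  "concentration_function K d m \<epsilon> =
     1 - (INF A\<in>{A \<in> sets m. measure m A \<ge> 1/2}. measure m (nbhd K d A \<epsilon>))"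

definition Levy_family ::
    "(nat \<Rightarrow> ('a, 'b) monoid_scheme) \<Rightarrow> (nat \<Rightarrow> 'a \<Rightarrow> 'a \<Rightarrow> real) \<Rightarrow> (nat \<Rightarrow> 'a measure) \<Rightarrow> bool" where
  "Levy_family G d m \<longleftrightarrow>
     (\<forall>\<epsilon>>0. (\<lambda>n. concentration_function (carrier (G n)) (d n) (m n) \<epsilon>) \<longlonglongrightarrow> 0)"

text \<open>Elements of \<open>L\<^sup>1(m)\<close> are represented by integrable functions, not identified almost everywhere.\<close>

definition prob_densities :: "'a measure \<Rightarrow> ('a \<Rightarrow> real) set" where
  "prob_densities m =
     {\<phi>. integrable m \<phi> \<and> (AE g in m. 0 \<le> \<phi> g) \<and> (\<integral>g. \<phi> g \<partial>m) = 1}"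

definition with_density :: "'a measure \<Rightarrow> ('a \<Rightarrow> real) \<Rightarrow> 'a measure" where
  "with_density m \<phi> = density m (\<lambda>g. ennreal (\<phi> g))"

definition left_translate :: "('a, 'b) monoid_scheme \<Rightarrow> 'a \<Rightarrow> ('a \<Rightarrow> real) \<Rightarrow> 'a \<Rightarrow> real" where
  "left_translate G h \<phi> = (\<lambda>g. \<phi> (inv\<^bsub>G\<^esub> h \<otimes>\<^bsub>G\<^esub> g))"

text \<open>
  The quantities below take values in \<^typ>\<open>ennreal\<close>, so that all suprema and integrals of
  nonnegative functions are unconditionally defined.
\<close>

definition total_variation :: "'a measure \<Rightarrow> ('a \<Rightarrow> real) \<Rightarrow> ('a \<Rightarrow> real) \<Rightarrow> ennreal" where
  "total_variation m \<phi> \<phi>' = (\<integral>\<^sup>+g. ennreal \<bar>\<phi> g - \<phi>' g\<bar> \<partial>m) / 2"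

definition Wasserstein_dist ::
    "'a set \<Rightarrow> ('a \<Rightarrow> 'a \<Rightarrow> real) \<Rightarrow> 'a measure \<Rightarrow> 'a measure \<Rightarrow> ennreal" where
  "Wasserstein_dist K d \<alpha> \<beta> =
     (SUP f\<in>{f :: 'a \<Rightarrow> real. \<forall>x\<in>K. \<forall>y\<in>K. \<bar>f x - f y\<bar> \<le> d x y}.
        ennreal \<bar>(\<integral>g. f g \<partial>\<alpha>) - (\<integral>g. f g \<partial>\<beta>)\<bar>)"

definition density_kernel :: "'a measure \<Rightarrow> 'z measure \<Rightarrow> ('z \<Rightarrow> 'a \<Rightarrow> real) \<Rightarrow> bool" where
  "density_kernel m \<zeta> \<Phi> \<longleftrightarrow>
     prob_space \<zeta> \<and>
     (\<lambda>(z, g). \<Phi> z g) \<in> borel_measurable (\<zeta> \<Otimes>\<^sub>M m) \<and>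
     (\<forall>z\<in>space \<zeta>. \<Phi> z \<in> prob_densities m)"

definition kernel_variation ::
    "('a, 'b) monoid_scheme \<Rightarrow> ('a \<Rightarrow> 'a \<Rightarrow> real) \<Rightarrow> 'a measure \<Rightarrow>
     'z measure \<Rightarrow> ('z \<Rightarrow> 'a \<Rightarrow> real) \<Rightarrow> real \<Rightarrow> ennreal" where
  "kernel_variation G d m \<zeta> \<Phi> r =
     (SUP h\<in>Metric_space.mcball (carrier G) d \<one>\<^bsub>G\<^esub> r.
        \<integral>\<^sup>+z. total_variation m (left_translate G h (\<Phi> z)) (\<Phi> z) \<partial>\<zeta>)"

definition kernel_Wasserstein ::
    "('a, 'b) monoid_scheme \<Rightarrow> ('a \<Rightarrow> 'a \<Rightarrow> real) \<Rightarrow> 'a measure \<Rightarrow>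
     'z measure \<Rightarrow> ('z \<Rightarrow> 'a \<Rightarrow> real) \<Rightarrow> ennreal" where
  "kernel_Wasserstein G d m \<zeta> \<Phi> =
     (\<integral>\<^sup>+z. Wasserstein_dist (carrier G) d (with_density m (\<Phi> z)) m \<partial>\<zeta>)"

text \<open>
  HOL cannot quantify over types inside a formula, so the type \<^typ>\<open>'z\<close> of the points of the
  indexing probability spaces is a parameter; the supremum is over all probability spaces (any
  subset of \<^typ>\<open>'z\<close> as underlying set, any sigma-algebra, any probability measure). Already
  for \<^typ>\<open>real\<close> in place of \<^typ>\<open>'z\<close> the supremum equals the one over all probability spaces
  whatsoever: both quantities of a kernel depend only on the law of the
  \<open>L\<^sup>1(m)\<close>-valued map \<open>z \<mapsto> \<phi>\<^sub>z\<close>, and \<open>L\<^sup>1(m)\<close> is Polish.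
\<close>

definition Wasserstein_modulus ::
    "'z itself \<Rightarrow> ('a, 'b) monoid_scheme \<Rightarrow> ('a \<Rightarrow> 'a \<Rightarrow> real) \<Rightarrow> 'a measure \<Rightarrow>
     real \<Rightarrow> real \<Rightarrow> ennreal" where
  "Wasserstein_modulus _ G d m r \<epsilon> =
     (SUP (\<zeta>, \<Phi>)\<in>{(\<zeta> :: 'z measure, \<Phi>).
          density_kernel m \<zeta> \<Phi> \<and> kernel_variation G d m \<zeta> \<Phi> r \<le> ennreal \<epsilon>}.
        kernel_Wasserstein G d m \<zeta> \<Phi>)"

definition Wasserstein_family ::
    "'z itself \<Rightarrow> (nat \<Rightarrow> ('a, 'b) monoid_scheme) \<Rightarrow> (nat \<Rightarrow> 'a \<Rightarrow> 'a \<Rightarrow> real) \<Rightarrow>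
     (nat \<Rightarrow> 'a measure) \<Rightarrow> bool" where
  "Wasserstein_family Z G d m \<longleftrightarrow>
     (\<exists>r :: nat \<Rightarrow> real. (\<forall>n. r n > 0) \<and> r \<longlonglongrightarrow> 0 \<and>
        (\<forall>\<epsilon> :: nat \<Rightarrow> real. (\<forall>n. \<epsilon> n > 0) \<and> \<epsilon> \<longlonglongrightarrow> 0 \<longrightarrow>
           (\<lambda>n. Wasserstein_modulus Z (G n) (d n) (m n) (r n) (\<epsilon> n)) \<longlonglongrightarrow> 0))"

end

theory Submission
  imports Defs
begin

text \<open>
  Let \<open>D\<close> be the distance to a set \<open>A\<close> of measure at least \<open>1/2\<close>. Normalising
  \<open>max 0 (1 - 2D/\<epsilon>)\<close> gives a density \<open>\<phi>\<close> that is \<open>4/\<epsilon>\<close>-Lipschitz, and right invariance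
  gives \<open>d(h\<^sup>-\<^sup>1g, g) = d(e, h)\<close>, so the variation of \<open>\<phi>\<close> under translations from the
  \<open>r\<close>-ball is at most \<open>2r/\<epsilon>\<close>. Since \<open>\<phi>\<close> lives where \<open>D < \<epsilon>/2\<close>, testing with the 1-Lipschitz
  function \<open>min (max 0 (D - \<epsilon>/2)) (\<epsilon>/2)\<close> shows that the Wasserstein distance of \<open>\<phi> m\<close> and \<open>m\<close>
  is at least \<open>\<epsilon>/2\<close> times the measure of the complement of the \<open>\<epsilon>\<close>-neighbourhood of \<open>A\<close>.
  Hence \<open>1 - m(B(A, \<epsilon>))\<close> is at most \<open>(2/\<epsilon>) \<Omega>(r, 2r/\<epsilon>)\<close>, uniformly in \<open>A\<close>; kernels over a
  one-point space are enough.
\<close>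

text \<open>The infimum is taken in the reals, so the value is meaningful only for nonempty
  \<open>A\<close>; hence the nonemptiness assumptions below.\<close>

definition set_dist :: "('a \<Rightarrow> 'a \<Rightarrow> real) \<Rightarrow> 'a set \<Rightarrow> 'a \<Rightarrow> real" where
  "set_dist d A x = (INF a\<in>A. d x a)"

context Metric_space
begin

lemma bdd_below_dist_image: "bdd_below (d x ` A)"
  by (rule bdd_belowI[of _ 0]) auto

lemma set_dist_less_iff:
  assumes "A \<noteq> {}"
  shows "set_dist d A x < c \<longleftrightarrow> (\<exists>a\<in>A. d x a < c)"
  unfolding set_dist_def using assms bdd_below_dist_image by (subst cInf_less_iff) auto

lemma set_dist_le_add:
  assumes "A \<subseteq> M" "A \<noteq> {}" "x \<in> M" "y \<in> M"
  shows "set_dist d A x \<le> d x y + set_dist d A y"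
proof -
  have "set_dist d A x - d x y \<le> set_dist d A y"
    unfolding set_dist_def[of d A y]
  proof (rule cINF_greatest[OF assms(2)])
    fix a assume a: "a \<in> A"
    have "set_dist d A x \<le> d x a"
      unfolding set_dist_def using bdd_below_dist_image a by (rule cINF_lower)
    also have "\<dots> \<le> d x y + d y a"
      using a assms by (intro triangle) auto
    finally show "set_dist d A x - d x y \<le> d y a" by simp
  qed
  then show ?thesis by simp
qed

lemma abs_set_dist_diff_le:
  assumes "A \<subseteq> M" "A \<noteq> {}" "x \<in> M" "y \<in> M"
  shows "\<bar>set_dist d A x - set_dist d A y\<bar> \<le> d x y"
  using set_dist_le_add[OF assms] set_dist_le_add[OF assms(1,2,4,3)] commute[of x y] by linarith

lemma set_dist_nonneg: "A \<noteq> {} \<Longrightarrow> 0 \<le> set_dist d A x"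
  unfolding set_dist_def by (rule cINF_greatest) auto

lemma set_dist_mem:
  assumes "A \<subseteq> M" "x \<in> A"
  shows "set_dist d A x = 0"
proof (rule antisym)
  show "set_dist d A x \<le> 0"
    using cINF_lower[OF bdd_below_dist_image assms(2), of x] assms
    by (auto simp: set_dist_def)
  show "0 \<le> set_dist d A x"
    using assms by (intro set_dist_nonneg) auto
qed

text \<open>Neighbourhoods are unions of open balls, so the strict inequality is the right one even
  when the infimum is not attained. Sublevel sets of \<open>set_dist\<close> are therefore open,
  which gives its Borel measurability.\<close>

lemma nbhd_eq_set_dist_less:
  assumes "A \<subseteq> M" "A \<noteq> {}"
  shows "nbhd M d A c = {x \<in> M. set_dist d A x < c}"
  using assms by (auto simp: nbhd_def set_dist_less_iff commute; blast)

lemma openin_nbhd: "openin mtopology (nbhd M d A c)"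
  unfolding nbhd_def by (intro openin_Union) auto

end

context measure_metric_group
begin

lemma set_dist_measurable:
  assumes "A \<subseteq> carrier G" "A \<noteq> {}"
  shows "set_dist d A \<in> borel_measurable m"
proof (rule borel_measurableI_less)
  fix c
  have "nbhd (carrier G) d A c \<in> sets m"
    using openin_nbhd by (auto simp: sets_Haar)
  then show "{x \<in> space m. set_dist d A x < c} \<in> sets m"
    by (simp add: nbhd_eq_set_dist_less[OF assms] space_Haar)
qed

text \<open>Both sides equal \<open>d (inv h) \<one>\<close>: translate that pair on the right by
  \<open>g\<close> for the left side and by \<open>h\<close> for the right side. So left translation
  by \<open>inv h\<close> moves every point by the same distance.\<close>

lemma dist_inv_mult:
  assumes "h \<in> carrier G" "g \<in> carrier G"
  shows "d (inv h \<otimes> g) g = d \<one> h"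
  using right_invariant_metric[of "inv h" "\<one>" g] right_invariant_metric[of "inv h" "\<one>" h] assms
  by simp

lemma kernel_variation_point_le:
  assumes lip: "\<And>x y. x \<in> carrier G \<Longrightarrow> y \<in> carrier G \<Longrightarrow> \<bar>\<phi> x - \<phi> y\<bar> \<le> L * d x y"
    and "L \<ge> 0" and "prob_space \<zeta>"
  shows "kernel_variation G d m \<zeta> (\<lambda>z. \<phi>) r \<le> ennreal (L * r / 2)"
  unfolding kernel_variation_def
proof (rule SUP_least)
  fix h assume "h \<in> mcball \<one> r"
  then have h: "h \<in> carrier G" "d \<one> h \<le> r" by auto
  interpret Z: prob_space \<zeta> by fact
  \<comment> \<open>The sign of \<open>r\<close> comes from the ball having a member; for negative
    \<open>r\<close> the supremum is over the empty set.\<close>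
  have "r \<ge> 0" using h nonneg[of "\<one>" h] by linarith
  have "(\<integral>\<^sup>+g. ennreal \<bar>left_translate G h \<phi> g - \<phi> g\<bar> \<partial>m) \<le> (\<integral>\<^sup>+g. ennreal (L * r) \<partial>m)"
  proof (intro nn_integral_mono ennreal_leI)
    fix g assume "g \<in> space m"
    then have g: "g \<in> carrier G" by (simp add: space_Haar)
    have "\<bar>\<phi> (inv h \<otimes> g) - \<phi> g\<bar> \<le> L * d (inv h \<otimes> g) g"
      using g h by (intro lip) auto
    also have "\<dots> \<le> L * r"
      using g h \<open>L \<ge> 0\<close> by (simp add: dist_inv_mult mult_left_mono)
    finally show "\<bar>left_translate G h \<phi> g - \<phi> g\<bar> \<le> L * r"
      by (simp add: left_translate_def)
  qed
  also have "\<dots> = ennreal (L * r)" by (simp add: emeasure_space_1)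
  finally have "total_variation m (left_translate G h \<phi>) \<phi> \<le> ennreal (L * r) / 2"
    unfolding total_variation_def by (rule divide_right_mono_ennreal)
  also have "\<dots> = ennreal (L * r / 2)"
    using \<open>L \<ge> 0\<close> \<open>r \<ge> 0\<close> divide_ennreal[of "L * r" 2] by simp
  finally show "(\<integral>\<^sup>+z. total_variation m (left_translate G h \<phi>) \<phi> \<partial>\<zeta>) \<le> ennreal (L * r / 2)"
    by (simp add: Z.emeasure_space_1)
qed

lemma Wasserstein_dist_le_modulus:
  assumes "\<phi> \<in> prob_densities m"
    and lip: "\<And>x y. x \<in> carrier G \<Longrightarrow> y \<in> carrier G \<Longrightarrow> \<bar>\<phi> x - \<phi> y\<bar> \<le> L * d x y"
    and "L \<ge> 0"
  shows "Wasserstein_dist (carrier G) d (with_density m \<phi>) m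
    \<le> Wasserstein_modulus TYPE('z) G d m r (L * r / 2)"
proof -
  \<comment> \<open>\<open>undefined\<close> is merely some point of the arbitrary type
    \<open>'z\<close>. The kernel is constant, so integrating over this Dirac measure returns the
    integrand.\<close>
  define \<zeta> :: "'z measure" where "\<zeta> = return (count_space UNIV) undefined"
  have \<zeta>: "prob_space \<zeta>" unfolding \<zeta>_def by (rule prob_space_return) simp
  have [measurable]: "\<phi> \<in> borel_measurable m"
    using assms(1) by (auto simp: prob_densities_def)
  have "density_kernel m \<zeta> (\<lambda>z. \<phi>)"
    unfolding density_kernel_def using \<zeta> assms(1) by simp
  moreover have "kernel_variation G d m \<zeta> (\<lambda>z. \<phi>) r \<le> ennreal (L * r / 2)"
    using lip \<open>L \<ge> 0\<close> \<zeta> by (rule kernel_variation_point_le)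
  ultimately have "kernel_Wasserstein G d m \<zeta> (\<lambda>z. \<phi>) \<le> Wasserstein_modulus TYPE('z) G d m r (L * r / 2)"
    unfolding Wasserstein_modulus_def by (intro SUP_upper2[of "(\<zeta>, \<lambda>z. \<phi>)"]) auto
  then show ?thesis
    by (simp add: kernel_Wasserstein_def prob_space.emeasure_space_1[OF \<zeta>])
qed

lemma measure_Compl_nbhd_le_modulus:
  assumes A: "A \<in> sets m" "measure m A \<ge> 1/2" and "\<epsilon> > 0"
  shows "ennreal (\<epsilon> / 2 * (1 - measure m (nbhd (carrier G) d A \<epsilon>)))
    \<le> Wasserstein_modulus TYPE('z) G d m r (2 * r / \<epsilon>)"
proof -
  have AK: "A \<subseteq> carrier G" using sets.sets_into_space[OF A(1)] by (simp add: space_Haar)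
  have ne: "A \<noteq> {}" using A(2) by auto
  let ?D = "set_dist d A"
  note [measurable] = set_dist_measurable[OF AK ne] A(1)
  define f where "f x = max 0 (1 - 2 * ?D x / \<epsilon>)" for x
  define c where "c = (\<integral>x. f x \<partial>m)"
  define \<phi> where "\<phi> x = f x / c" for x
  \<comment> \<open>The lower cut-off makes \<open>F\<close> vanish on the support of
    \<open>f\<close>; the upper one keeps it bounded, hence integrable, with value \<epsilon>/2 off
    the \<epsilon>-neighbourhood.\<close>
  define F where "F x = min (max 0 (?D x - \<epsilon> / 2)) (\<epsilon> / 2)" for x
  have [measurable]: "f \<in> borel_measurable m" "\<phi> \<in> borel_measurable m" "F \<in> borel_measurable m"
    unfolding f_def \<phi>_def F_def by measurable
  have f01: "0 \<le> f x" "f x \<le> 1" for x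
    using set_dist_nonneg[OF ne, of x] \<open>\<epsilon> > 0\<close> by (auto simp: f_def)
  have intf: "integrable m f"
    by (rule integrable_const_bound[of _ 1]) (use f01 in auto)
  \<comment> \<open>Since \<open>f\<close> is 1 on \<open>A\<close>, its integral \<open>c\<close>
    is at least 1/2. Normalising thus at most doubles the Lipschitz constant 2/\<epsilon> of
    \<open>f\<close>.\<close>
  have "measure m A = (\<integral>x. indicator A x \<partial>m)"
    using A(1) by (simp add: sets.Int_space_eq2)
  also have "\<dots> \<le> c"
    unfolding c_def
  proof (rule integral_mono[OF _ intf])
    show "integrable m (indicator A :: 'a \<Rightarrow> real)"
      by (rule integrable_const_bound[of _ 1]) (auto simp: indicator_def)
    show "indicator A x \<le> f x" for x
      using f01[of x] set_dist_mem[OF AK, of x] by (auto simp: indicator_def f_def)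
  qed
  finally have c: "c \<ge> 1/2" using A(2) by linarith
  have dens: "\<phi> \<in> prob_densities m"
    unfolding prob_densities_def \<phi>_def using intf c f01 by (auto simp: c_def[symmetric])
  have lip\<phi>: "\<bar>\<phi> x - \<phi> y\<bar> \<le> 4 / \<epsilon> * d x y" if "x \<in> carrier G" "y \<in> carrier G" for x y
  proof -
    have "\<bar>f x - f y\<bar> \<le> \<bar>2 * ?D x / \<epsilon> - 2 * ?D y / \<epsilon>\<bar>"
      by (auto simp: f_def max_def)
    also have "\<dots> = 2 / \<epsilon> * \<bar>?D x - ?D y\<bar>"
    proof -
      have "2 * ?D x / \<epsilon> - 2 * ?D y / \<epsilon> = 2 / \<epsilon> * (?D x - ?D y)"
        by (simp add: diff_divide_distrib right_diff_distrib)
      then show ?thesis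
        using \<open>\<epsilon> > 0\<close> by (simp only: abs_mult) simp
    qed
    also have "\<dots> \<le> 2 / \<epsilon> * d x y"
      using \<open>\<epsilon> > 0\<close> abs_set_dist_diff_le[OF AK ne that] by (intro mult_left_mono) auto
    finally have *: "\<bar>f x - f y\<bar> \<le> 2 / \<epsilon> * d x y" .
    have "\<bar>\<phi> x - \<phi> y\<bar> = \<bar>f x - f y\<bar> / c"
      using c by (simp add: \<phi>_def flip: diff_divide_distrib)
    also have "\<dots> \<le> \<bar>f x - f y\<bar> / (1 / 2)"
      using c by (intro divide_left_mono) auto
    finally show ?thesis using * by simp
  qed
  have lipF: "\<forall>x\<in>carrier G. \<forall>y\<in>carrier G. \<bar>F x - F y\<bar> \<le> d x y"
  proof (intro ballI)
    fix x y assume "x \<in> carrier G" "y \<in> carrier G"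
    then show "\<bar>F x - F y\<bar> \<le> d x y"
      using abs_set_dist_diff_le[OF AK ne, of x y] by (auto simp: F_def min_def max_def)
  qed
  \<comment> \<open>\<open>f\<close> is nonzero only where the distance is below \<epsilon>/2, and
    \<open>F\<close> only where it is above.\<close>
  have "\<phi> x * F x = 0" for x
    using \<open>\<epsilon> > 0\<close> by (auto simp: \<phi>_def f_def F_def max_def min_def field_simps)
  moreover have "(\<integral>g. F g \<partial>with_density m \<phi>) = (\<integral>g. \<phi> g * F g \<partial>m)"
    unfolding with_density_def using f01 c
    by (subst integral_density) (auto simp: \<phi>_def)
  ultimately have F0: "(\<integral>g. F g \<partial>with_density m \<phi>) = 0"
    by (simp only: integral_zero)
  let ?N = "nbhd (carrier G) d A \<epsilon>"
  have N: "?N = {x \<in> space m. ?D x < \<epsilon>}"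
    by (simp add: nbhd_eq_set_dist_less[OF AK ne] space_Haar)
  have [measurable]: "?N \<in> sets m" unfolding N by measurable
  have "\<epsilon> / 2 * (1 - measure m ?N) = \<epsilon> / 2 * measure m (space m - ?N)"
    by (simp add: prob_compl)
  also have "\<dots> = (\<integral>x. \<epsilon> / 2 * indicator (space m - ?N) x \<partial>m)"
    by simp
  also have "\<dots> \<le> (\<integral>x. F x \<partial>m)"
  proof (rule integral_mono)
    show "integrable m (\<lambda>x. \<epsilon> / 2 * indicator (space m - ?N) x)"
      by (rule integrable_const_bound[of _ "\<epsilon> / 2"]) (use \<open>\<epsilon> > 0\<close> in \<open>auto simp: indicator_def\<close>)
    show "integrable m F"
      by (rule integrable_const_bound[of _ "\<epsilon> / 2"]) (use \<open>\<epsilon> > 0\<close> in \<open>auto simp: F_def min_def max_def\<close>)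
    show "\<epsilon> / 2 * indicator (space m - ?N) x \<le> F x" for x
      using \<open>\<epsilon> > 0\<close> by (auto simp: indicator_def N F_def)
  qed
  also have "\<dots> \<le> \<bar>(\<integral>g. F g \<partial>with_density m \<phi>) - (\<integral>g. F g \<partial>m)\<bar>"
    by (simp add: F0)
  finally have "ennreal (\<epsilon> / 2 * (1 - measure m ?N))
      \<le> ennreal \<bar>(\<integral>g. F g \<partial>with_density m \<phi>) - (\<integral>g. F g \<partial>m)\<bar>"
    by (rule ennreal_leI)
  also have "\<dots> \<le> Wasserstein_dist (carrier G) d (with_density m \<phi>) m"
    unfolding Wasserstein_dist_def using lipF by (intro SUP_upper) simp
  also have "\<dots> \<le> Wasserstein_modulus TYPE('z) G d m r (4 / \<epsilon> * r / 2)"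
    using dens lip\<phi> \<open>\<epsilon> > 0\<close> by (intro Wasserstein_dist_le_modulus) auto
  finally show ?thesis by simp
qed

text \<open>The whole group is one of the competing sets, so the infimum is at most 1.\<close>

lemma concentration_function_nonneg: "0 \<le> concentration_function (carrier G) d m \<epsilon>"
proof -
  have "(INF A\<in>{A \<in> sets m. measure m A \<ge> 1/2}. measure m (nbhd (carrier G) d A \<epsilon>))
      \<le> measure m (nbhd (carrier G) d (space m) \<epsilon>)"
    by (rule cINF_lower) (auto intro: bdd_belowI[of _ 0] simp: prob_space)
  also have "\<dots> \<le> 1" by simp
  finally show ?thesis by (simp add: concentration_function_def)
qed

lemma concentration_function_le:
  assumes "\<epsilon> > 0" "\<eta> > 0"
    and "Wasserstein_modulus TYPE('z) G d m r (2 * r / \<epsilon>) \<le> ennreal (\<epsilon> / 2 * \<eta>)"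
  shows "concentration_function (carrier G) d m \<epsilon> \<le> \<eta>"
proof -
  have "1 - \<eta> \<le> (INF A\<in>{A \<in> sets m. measure m A \<ge> 1/2}. measure m (nbhd (carrier G) d A \<epsilon>))"
  proof (rule cINF_greatest)
    show "{A \<in> sets m. measure m A \<ge> 1/2} \<noteq> {}"
      using prob_space by (auto intro!: exI[of _ "space m"])
    fix A assume "A \<in> {A \<in> sets m. measure m A \<ge> 1/2}"
    then have "ennreal (\<epsilon> / 2 * (1 - measure m (nbhd (carrier G) d A \<epsilon>))) \<le> ennreal (\<epsilon> / 2 * \<eta>)"
      using order_trans[OF measure_Compl_nbhd_le_modulus assms(3)] \<open>\<epsilon> > 0\<close> by auto
    \<comment> \<open>Returning from \<open>ennreal\<close> to the reals requires a nonnegative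
      right-hand side, which positivity of \<epsilon> and \<eta> supplies.\<close>
    then have "\<epsilon> / 2 * (1 - measure m (nbhd (carrier G) d A \<epsilon>)) \<le> \<epsilon> / 2 * \<eta>"
      using assms by (subst (asm) ennreal_le_iff) auto
    then show "1 - \<eta> \<le> measure m (nbhd (carrier G) d A \<epsilon>)"
      using \<open>\<epsilon> > 0\<close> by (subst (asm) mult_le_cancel_left_pos) auto
  qed
  then show ?thesis by (simp add: concentration_function_def)
qed

end

theorem corollary2p5:
  fixes G :: "nat \<Rightarrow> ('a, 'b) monoid_scheme"
    and d :: "nat \<Rightarrow> 'a \<Rightarrow> 'a \<Rightarrow> real"
    and m :: "nat \<Rightarrow> 'a measure"
  assumes "\<And>n. measure_metric_group (G n) (d n) (m n)"
    and "Wasserstein_family TYPE('z) G d m"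
  shows "Levy_family G d m"
  unfolding Levy_family_def
proof (intro allI impI)
  fix \<epsilon> :: real assume "\<epsilon> > 0"
  obtain r where r: "\<And>n. r n > 0" "r \<longlonglongrightarrow> 0"
    and W: "\<And>e. (\<forall>n. e n > 0) \<Longrightarrow> e \<longlonglongrightarrow> 0 \<Longrightarrow>
      (\<lambda>n. Wasserstein_modulus TYPE('z) (G n) (d n) (m n) (r n) (e n)) \<longlonglongrightarrow> 0"
    using assms(2) unfolding Wasserstein_family_def by blast
  \<comment> \<open>The variation bounds 2 r_n/\<epsilon> form a positive null sequence, so they are
    admissible in the definition of a Wasserstein family.\<close>
  have "(\<lambda>n. 2 * r n / \<epsilon>) \<longlonglongrightarrow> 2 * 0 / \<epsilon>"
    using \<open>\<epsilon> > 0\<close> r(2) by (intro tendsto_intros) auto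
  then have lim: "(\<lambda>n. Wasserstein_modulus TYPE('z) (G n) (d n) (m n) (r n) (2 * r n / \<epsilon>)) \<longlonglongrightarrow> 0"
    using \<open>\<epsilon> > 0\<close> r(1) by (intro W) auto
  show "(\<lambda>n. concentration_function (carrier (G n)) (d n) (m n) \<epsilon>) \<longlonglongrightarrow> 0"
  proof (rule order_tendstoI)
    fix a :: real assume "a < 0"
    then show "\<forall>\<^sub>F n in sequentially. a < concentration_function (carrier (G n)) (d n) (m n) \<epsilon>"
      using measure_metric_group.concentration_function_nonneg[OF assms(1)]
      by (intro always_eventually) (auto intro: less_le_trans)
  next
    fix a :: real assume "0 < a"
    \<comment> \<open>Aiming at \<open>a / 2\<close> turns the non-strict bound of
      \<open>concentration_function_le\<close> into the strict one needed.\<close>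
    have "\<forall>\<^sub>F n in sequentially.
        Wasserstein_modulus TYPE('z) (G n) (d n) (m n) (r n) (2 * r n / \<epsilon>) < ennreal (\<epsilon> / 2 * (a / 2))"
      using \<open>\<epsilon> > 0\<close> \<open>0 < a\<close> by (intro order_tendstoD(2)[OF lim]) simp
    then show "\<forall>\<^sub>F n in sequentially. concentration_function (carrier (G n)) (d n) (m n) \<epsilon> < a"
    proof eventually_elim
      case (elim n)
      have "concentration_function (carrier (G n)) (d n) (m n) \<epsilon> \<le> a / 2"
        using measure_metric_group.concentration_function_le[OF assms(1) \<open>\<epsilon> > 0\<close> _ less_imp_le[OF elim]]
          \<open>0 < a\<close> by simp
      then show ?case using \<open>0 < a\<close> by simp
    qed
  qed
qed

end
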